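(* Let $G$ be a ribbon graph and let $A\subseteq E(G)$. Then the partial dual $G^{A}$ is Eulerian if and only if there is a crossing-total direction of the medial graph $G_m$ of $G$ such that $A$ is the union of the set of all $d$-edges and a (possibly empty, possibly full) subset of the set of $t$-edges arising from this crossing-total direction.
   Context: Graphs are finite, not necessarily connected, and may have loops and multiple edges. A graph is Eulerian if every vertex has even degree (number of incident half-edges; connectedness is not required). Ribbon graph. A ribbon graph $G=(V(G),E(G))$ is a (possibly non-orientable) surface with boundary represented as the union of two sets of topological discs, a set $V(G)$ of vertices and a set $E(G)$ of edges, such that: the vertices and edges intersect in disjoint line segments (common line segments); each such line segment lies on the boundary of precisely one vertex and precisely one edge; every edge contains exactly two such line segments. Removing the two common line segments from the boundary of an edge disc leaves its two edge line segments. Ribbon graphs are equivalent to graphs cellularly embedded in closed surfaces (gluing a disc to each boundary component gives the surface; the glued discs are the faces), and one moves freely between the two. Arrow presentation. An arrow presentation is a set of circles with labelled arrows on them, exactly two arrows for each label. It determines a ribbon graph: each circle is the boundary of a vertex disc; for each label $e$ take an edge disc, orient its boundary, place two disjoint arrows on its boundary pointing in the direction of the orientation, and identify these with the two $e$-labelled arrows. Partial dual. Let $A\subseteq E(G)$. Arbitrarily orient (the boundary of) and label each edge disc of $G$. The boundary components of the spanning ribbon subgraph $(V(G),A)$ meet the edges of $G$ in disjoint arcs (for $e\in A$ the two edge line segments of $e$; for $e\notin A$ the two common line segments of $e$). On each of these arcs place an arrow pointing in the direction of the orientation of the edge boundary, labelled by the edge it meets. The resulting arrow presentation determines the partial dual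 $G^A$. Medial graph. For $G$ cellularly embedded in $\Sigma$, the medial graph $G_m$ is the 4-regular graph embedded in $\Sigma$ obtained by placing a vertex $v(e)$ on each edge $e$ of $G$ and, for each face $f$ with boundary $v_1e_1v_2e_2\cdots v_{d}e_{d}$, drawing edges $(v(e_1),v(e_2)),(v(e_2),v(e_3)),\dots,(v(e_d),v(e_1))$ without intersections inside $f$ following its boundary (so edges of $G_m$ correspond to the corners of $G$). The canonical checkerboard colouring of $G_m$ colours black the faces of $G_m$ containing a vertex of $G$ and white the remaining faces; around each $v(e)$ the four corners are alternately black and white. Crossing-total direction. A crossing-total direction of $G_m$ is an orientation of the edges of $G_m$ such that at each vertex $v(e)$ the four incident half-edges are, in cyclic order around $v(e)$, oriented "in, in, out, out", or "in, in, in, in", or "out, out, out, out". In the first case $v(e)$ is a $c$-vertex if the two incoming half-edges bound a black corner at $v(e)$ (equivalently, so do the two outgoing ones), and a $d$-vertex if the two incoming half-edges bound a white corner at $v(e)$. In the last two cases $v(e)$ is a $t$-vertex. The edge $e$ of $G$ is a $c$-edge, $d$-edge or $t$-edge according to the type of $v(e)$. *)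

theory Defs
  imports Main
begin

text \<open>
  A ribbon graph is recorded through the points (flags) at which a common line segment meets an
  edge line segment.  The flags cut the boundaries of all discs into segments of three kinds, and
  each kind pairs up the flags:
  \<^item> \<open>cseg\<close> exchanges the two ends of a common line segment,
  \<^item> \<open>eseg\<close> exchanges the two ends of an edge line segment,
  \<^item> \<open>vseg\<close> exchanges the two ends of an arc of a vertex boundary that lies between two
    consecutive common line segments (a corner).

  The boundary of an edge disc is the 4-cycle \<open>x, cseg x, eseg (cseg x), eseg x\<close>.  Vertex discs
  without common line segments carry no flags and are listed separately in \<open>bare\<close>.
\<close>

record ('f, 'v) ribbon_graph =
  flags :: "'f set"
  cseg :: "'f \<Rightarrow> 'f"
  eseg :: "'f \<Rightarrow> 'f"
  vseg :: "'f \<Rightarrow> 'f"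
  bare :: "'v set"

definition pairing_on :: "'a set \<Rightarrow> ('a \<Rightarrow> 'a) \<Rightarrow> bool" where
  "pairing_on X f \<longleftrightarrow> (\<forall>x\<in>X. f x \<in> X \<and> f x \<noteq> x \<and> f (f x) = x)"

definition is_ribbon_graph :: "('f, 'v) ribbon_graph \<Rightarrow> bool" where
  "is_ribbon_graph G \<longleftrightarrow>
     finite (flags G) \<and> finite (bare G) \<and>
     pairing_on (flags G) (cseg G) \<and>
     pairing_on (flags G) (eseg G) \<and>
     pairing_on (flags G) (vseg G) \<and>
     (\<forall>x\<in>flags G. cseg G (eseg G x) = eseg G (cseg G x) \<and> cseg G x \<noteq> eseg G x)"

text \<open>The closed curve through \<open>x\<close> formed by the segments of two kinds.\<close>

definition circle :: "('a \<Rightarrow> 'a) \<Rightarrow> ('a \<Rightarrow> 'a) \<Rightarrow> 'a \<Rightarrow> 'a set" where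
  "circle f g x = {y. (\<lambda>u w. w = f u \<or> w = g u)\<^sup>*\<^sup>* x y}"

definition verts :: "('f, 'v) ribbon_graph \<Rightarrow> ('f set + 'v) set" where
  "verts G = Inl ` (circle (cseg G) (vseg G) ` flags G) \<union> Inr ` bare G"

definition vertex_flags :: "'f set + 'v \<Rightarrow> 'f set" where
  "vertex_flags v = (case v of Inl c \<Rightarrow> c | Inr _ \<Rightarrow> {})"

definition edge_of :: "('f, 'v) ribbon_graph \<Rightarrow> 'f \<Rightarrow> 'f set" where
  "edge_of G x = {x, cseg G x, eseg G x, eseg G (cseg G x)}"

definition edges :: "('f, 'v) ribbon_graph \<Rightarrow> 'f set set" where
  "edges G = edge_of G ` flags G"

text \<open>Half-edges are identified with common line segments, so a loop has two of them.\<close>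

definition half_edge :: "('f, 'v) ribbon_graph \<Rightarrow> 'f \<Rightarrow> 'f set" where
  "half_edge G x = {x, cseg G x}"

definition half_edges :: "('f, 'v) ribbon_graph \<Rightarrow> 'f set set" where
  "half_edges G = half_edge G ` flags G"

definition degree :: "('f, 'v) ribbon_graph \<Rightarrow> 'f set + 'v \<Rightarrow> nat" where
  "degree G v = card {h \<in> half_edges G. h \<subseteq> vertex_flags v}"

definition eulerian :: "('f, 'v) ribbon_graph \<Rightarrow> bool" where
  "eulerian G \<longleftrightarrow> (\<forall>v\<in>verts G. even (degree G v))"


text \<open>
  An arrow presentation, recorded through the end points of its arrows: \<open>other_end\<close> exchanges the
  two ends of an arrow, \<open>arc\<close> the two ends of an arc between consecutive arrows on a circle, and
  \<open>heads\<close> are the end points that are heads.  The circles without arrows are listed in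
  \<open>bare_circles\<close>.
\<close>

record ('p, 'l, 'v) arrow_presentation =
  ends :: "'p set"
  other_end :: "'p \<Rightarrow> 'p"
  arc :: "'p \<Rightarrow> 'p"
  heads :: "'p set"
  label :: "'p \<Rightarrow> 'l"
  bare_circles :: "'v set"

text \<open>
  Both arrows with label \<open>e\<close> follow the orientation of the boundary of the edge disc \<open>e\<close>, so the
  remaining two boundary segments of that disc join the head of either arrow to the tail of the
  other one.
\<close>

definition ribbon_of_arrows :: "('p, 'l, 'v) arrow_presentation \<Rightarrow> ('p, 'v) ribbon_graph" where
  "ribbon_of_arrows P =
    \<lparr> flags = ends P,
      cseg = other_end P,
      eseg = (\<lambda>p. THE q. q \<in> ends P \<and> label P q = label P p \<and>
                q \<noteq> p \<and> q \<noteq> other_end P p \<and> (q \<in> heads P \<longleftrightarrow> p \<notin> heads P)),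
      vseg = arc P,
      bare = bare_circles P \<rparr>"

text \<open>
  An orientation of the boundaries of all edge discs, given by the set of flags at which the
  oriented boundary enters a common line segment (from \<open>x\<close> to \<open>cseg x\<close>); at the other flags it
  enters an edge line segment (from \<open>x\<close> to \<open>eseg x\<close>).
\<close>

definition edge_orientation :: "('f, 'v) ribbon_graph \<Rightarrow> 'f set \<Rightarrow> bool" where
  "edge_orientation G T \<longleftrightarrow> T \<subseteq> flags G \<and>
     (\<forall>x\<in>flags G. (cseg G x \<in> T \<longleftrightarrow> x \<notin> T) \<and> (eseg G x \<in> T \<longleftrightarrow> x \<notin> T))"

text \<open>
  The boundary of the spanning ribbon subgraph with edge set \<open>A\<close> consists of all corners, the edge
  line segments of the edges in \<open>A\<close>, the common line segments of the edges not in \<open>A\<close>, and the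
  boundaries of the bare vertices.
\<close>

definition dual_arrows ::
  "('f, 'v) ribbon_graph \<Rightarrow> 'f set \<Rightarrow> 'f set set \<Rightarrow> ('f, 'f set, 'v) arrow_presentation" where
  "dual_arrows G T A =
    \<lparr> ends = flags G,
      other_end = (\<lambda>x. if edge_of G x \<in> A then eseg G x else cseg G x),
      arc = vseg G,
      heads = {x \<in> flags G. if edge_of G x \<in> A then x \<in> T else x \<notin> T},
      label = edge_of G,
      bare_circles = bare G \<rparr>"

definition partial_dual ::
  "('f, 'v) ribbon_graph \<Rightarrow> 'f set \<Rightarrow> 'f set set \<Rightarrow> ('f, 'v) ribbon_graph" where
  "partial_dual G T A = ribbon_of_arrows (dual_arrows G T A)"


text \<open>
  The medial graph as a ribbon graph.  Its edges are the corners \<open>{x, vseg x}\<close> of \<open>G\<close> and its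
  half-edges are therefore indexed by the flags of \<open>G\<close>; around \<open>v(e)\<close> they follow the four flags of
  the edge disc \<open>e\<close>.  The flag \<open>(x, a)\<close> lies on the side of the half-edge \<open>x\<close> facing a vertex
  (\<open>a = Black\<close>) or a face (\<open>a = White\<close>) of \<open>G\<close>: at \<open>v(e)\<close>, the half-edges \<open>x\<close> and \<open>cseg x\<close> bound a
  corner containing a common line segment, and \<open>x\<close> and \<open>eseg x\<close> one containing an edge line segment.
\<close>

datatype colour = Black | White

fun flip :: "colour \<Rightarrow> colour" where
  "flip Black = White"
| "flip White = Black"

definition medial_graph :: "('f, 'v) ribbon_graph \<Rightarrow> ('f \<times> colour, 'v) ribbon_graph" where
  "medial_graph G =
    \<lparr> flags = flags G \<times> UNIV,
      cseg = (\<lambda>(x, a). (x, flip a)),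
      eseg = (\<lambda>(x, a). (vseg G x, a)),
      vseg = (\<lambda>(x, a). case a of Black \<Rightarrow> (cseg G x, Black) | White \<Rightarrow> (eseg G x, White)),
      bare = {} \<rparr>"

definition medial_vertex :: "'f set \<Rightarrow> ('f \<times> colour) set + 'v" where
  "medial_vertex e = Inl (e \<times> UNIV)"

definition faces :: "('f, 'v) ribbon_graph \<Rightarrow> 'f set set" where
  "faces G = circle (eseg G) (vseg G) ` flags G"

text \<open>
  The face of the medial graph containing the vertex \<open>v\<close> of \<open>G\<close> is the one whose boundary runs along
  the black sides of the corners at \<open>v\<close>.
\<close>

definition black_faces :: "('f, 'v) ribbon_graph \<Rightarrow> ('f \<times> colour) set set" where
  "black_faces G = {F \<in> faces (medial_graph G). \<exists>v\<in>verts G. F = vertex_flags v \<times> {Black}}"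

definition white_faces :: "('f, 'v) ribbon_graph \<Rightarrow> ('f \<times> colour) set set" where
  "white_faces G = faces (medial_graph G) - black_faces G"


text \<open>A direction of the edges, given by the set of those half-edges that leave their vertex.\<close>

definition direction :: "('f, 'v) ribbon_graph \<Rightarrow> 'f set set \<Rightarrow> bool" where
  "direction H D \<longleftrightarrow> D \<subseteq> half_edges H \<and>
     (\<forall>x\<in>flags H. half_edge H x \<in> D \<longleftrightarrow> half_edge H (eseg H x) \<notin> D)"

text \<open>
  One step around a vertex: the half-edges at \<open>x\<close> and at \<open>rot x\<close> are the two that bound the corner
  \<open>{x, vseg x}\<close>.
\<close>

definition rot :: "('f, 'v) ribbon_graph \<Rightarrow> 'f \<Rightarrow> 'f" where
  "rot H x = cseg H (vseg H x)"

text \<open>The cyclic pattern in, in, out, out whose incoming half-edges bound the corner \<open>{x, vseg x}\<close>.\<close>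

definition in_in_out_out :: "('f, 'v) ribbon_graph \<Rightarrow> 'f set set \<Rightarrow> 'f \<Rightarrow> bool" where
  "in_in_out_out H D x \<longleftrightarrow>
     half_edge H x \<notin> D \<and> half_edge H (rot H x) \<notin> D \<and>
     half_edge H (rot H (rot H x)) \<in> D \<and> half_edge H (rot H (rot H (rot H x))) \<in> D"

definition all_in_or_all_out :: "('f, 'v) ribbon_graph \<Rightarrow> 'f set set \<Rightarrow> 'f set + 'v \<Rightarrow> bool" where
  "all_in_or_all_out H D w \<longleftrightarrow>
     (\<forall>x\<in>vertex_flags w. half_edge H x \<notin> D) \<or> (\<forall>x\<in>vertex_flags w. half_edge H x \<in> D)"

definition crossing_total_direction ::
  "('f, 'v) ribbon_graph \<Rightarrow> ('f \<times> colour) set set \<Rightarrow> bool" where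
  "crossing_total_direction G D \<longleftrightarrow>
     direction (medial_graph G) D \<and>
     (\<forall>w\<in>verts (medial_graph G).
        (\<exists>x\<in>vertex_flags w. in_in_out_out (medial_graph G) D x) \<or>
        all_in_or_all_out (medial_graph G) D w)"

definition c_vertex ::
  "('f, 'v) ribbon_graph \<Rightarrow> ('f \<times> colour) set set \<Rightarrow> ('f \<times> colour) set + 'v \<Rightarrow> bool" where
  "c_vertex G D w \<longleftrightarrow>
     (\<exists>x\<in>vertex_flags w. in_in_out_out (medial_graph G) D x \<and> (\<exists>F\<in>black_faces G. x \<in> F))"

definition d_vertex ::
  "('f, 'v) ribbon_graph \<Rightarrow> ('f \<times> colour) set set \<Rightarrow> ('f \<times> colour) set + 'v \<Rightarrow> bool" where
  "d_vertex G D w \<longleftrightarrow>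
     (\<exists>x\<in>vertex_flags w. in_in_out_out (medial_graph G) D x \<and> (\<exists>F\<in>white_faces G. x \<in> F))"

definition t_vertex ::
  "('f, 'v) ribbon_graph \<Rightarrow> ('f \<times> colour) set set \<Rightarrow> ('f \<times> colour) set + 'v \<Rightarrow> bool" where
  "t_vertex G D w \<longleftrightarrow> all_in_or_all_out (medial_graph G) D w"

definition c_edges :: "('f, 'v) ribbon_graph \<Rightarrow> ('f \<times> colour) set set \<Rightarrow> 'f set set" where
  "c_edges G D = {e \<in> edges G. c_vertex G D (medial_vertex e)}"

definition d_edges :: "('f, 'v) ribbon_graph \<Rightarrow> ('f \<times> colour) set set \<Rightarrow> 'f set set" where
  "d_edges G D = {e \<in> edges G. d_vertex G D (medial_vertex e)}"

definition t_edges :: "('f, 'v) ribbon_graph \<Rightarrow> ('f \<times> colour) set set \<Rightarrow> 'f set set" where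
  "t_edges G D = {e \<in> edges G. t_vertex G D (medial_vertex e)}"


lemma ribbon_graphD:
  assumes "is_ribbon_graph G" "x \<in> flags G"
  shows "cseg G x \<in> flags G" "cseg G x \<noteq> x" "cseg G (cseg G x) = x"
    "eseg G x \<in> flags G" "eseg G x \<noteq> x" "eseg G (eseg G x) = x"
    "vseg G x \<in> flags G" "vseg G x \<noteq> x" "vseg G (vseg G x) = x"
    "cseg G (eseg G x) = eseg G (cseg G x)" "cseg G x \<noteq> eseg G x" "eseg G (cseg G x) \<noteq> x"
  using assms unfolding is_ribbon_graph_def pairing_on_def by (blast, blast, blast, blast, blast,
    blast, blast, blast, blast, blast, blast, metis)

lemma four_flags:
  assumes "is_ribbon_graph G" "x \<in> flags G"
  shows "cseg G x \<in> flags G" "eseg G x \<in> flags G" "eseg G (cseg G x) \<in> flags G"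
    "cseg G (cseg G x) = x" "eseg G (eseg G x) = x" "cseg G (eseg G x) = eseg G (cseg G x)"
    "eseg G (eseg G (cseg G x)) = cseg G x" "cseg G (eseg G (cseg G x)) = eseg G x"
    "x \<noteq> cseg G x" "x \<noteq> eseg G x" "x \<noteq> eseg G (cseg G x)" "cseg G x \<noteq> eseg G x"
    "cseg G x \<noteq> eseg G (cseg G x)" "eseg G x \<noteq> eseg G (cseg G x)"
proof -
  note R = ribbon_graphD[OF assms(1)]
  have c: "cseg G x \<in> flags G" and e: "eseg G x \<in> flags G" using R assms(2) by blast+
  note f = R[OF assms(2)] R[OF c] R[OF e]
  show "cseg G x \<in> flags G" "eseg G x \<in> flags G" "eseg G (cseg G x) \<in> flags G"
    "cseg G (cseg G x) = x" "eseg G (eseg G x) = x" "cseg G (eseg G x) = eseg G (cseg G x)"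
    "eseg G (eseg G (cseg G x)) = cseg G x" "cseg G (eseg G (cseg G x)) = eseg G x"
    "x \<noteq> cseg G x" "x \<noteq> eseg G x" "x \<noteq> eseg G (cseg G x)" "cseg G x \<noteq> eseg G x"
    "cseg G x \<noteq> eseg G (cseg G x)" "eseg G x \<noteq> eseg G (cseg G x)"
    using f by auto
qed

lemma edge_of_cong:
  assumes "is_ribbon_graph G" "x \<in> flags G" "y \<in> edge_of G x"
  shows "y \<in> flags G" "edge_of G y = edge_of G x"
proof -
  note f = four_flags[OF assms(1,2)]
  have y: "y = x \<or> y = cseg G x \<or> y = eseg G x \<or> y = eseg G (cseg G x)"
    using assms(3) by (simp add: edge_of_def)
  then show "y \<in> flags G" using f assms(2) by auto
  show "edge_of G y = edge_of G x"
    using y by (elim disjE) (auto simp: edge_of_def f)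
qed

lemma edge_of_seg:
  assumes "is_ribbon_graph G" "x \<in> flags G"
  shows "edge_of G (cseg G x) = edge_of G x" "edge_of G (eseg G x) = edge_of G x"
proof -
  have "cseg G x \<in> edge_of G x" "eseg G x \<in> edge_of G x" by (simp_all add: edge_of_def)
  then show "edge_of G (cseg G x) = edge_of G x" "edge_of G (eseg G x) = edge_of G x"
    using edge_of_cong(2)[OF assms] by blast+
qed

lemma edge_orientation_exists:
  assumes G: "is_ribbon_graph G"
  shows "\<exists>T. edge_orientation G T"
proof -
  note R = ribbon_graphD[OF G]
  define r where "r e = (SOME y. y \<in> e)" for e :: "'a set"
  define T where "T = {x \<in> flags G. x = r (edge_of G x) \<or> x = eseg G (cseg G (r (edge_of G x)))}"
  have "(cseg G x \<in> T \<longleftrightarrow> x \<notin> T) \<and> (eseg G x \<in> T \<longleftrightarrow> x \<notin> T)" if x: "x \<in> flags G" for x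
  proof -
    have "x \<in> edge_of G x" by (simp add: edge_of_def)
    then have "r (edge_of G x) \<in> edge_of G x" unfolding r_def by (rule someI)
    then consider "r (edge_of G x) = x" | "r (edge_of G x) = cseg G x"
      | "r (edge_of G x) = eseg G x" | "r (edge_of G x) = eseg G (cseg G x)"
      by (auto simp: edge_of_def)
    moreover have "edge_of G (cseg G x) = edge_of G x" "edge_of G (eseg G x) = edge_of G x"
      by (rule edge_of_seg[OF G x])+
    moreover have "cseg G x \<in> flags G" "eseg G x \<in> flags G" "cseg G (cseg G x) = x"
      "eseg G (eseg G x) = x" "cseg G (eseg G x) = eseg G (cseg G x)"
      "eseg G (eseg G (cseg G x)) = cseg G x" "cseg G (eseg G (cseg G x)) = eseg G x"
      "x \<noteq> cseg G x" "x \<noteq> eseg G x" "x \<noteq> eseg G (cseg G x)" "cseg G x \<noteq> eseg G x"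
      "cseg G x \<noteq> eseg G (cseg G x)" "eseg G x \<noteq> eseg G (cseg G x)"
      using four_flags[OF G x] by simp_all
    ultimately show ?thesis
      unfolding T_def using x by cases auto
  qed
  moreover have "T \<subseteq> flags G" by (simp add: T_def)
  ultimately have "edge_orientation G T" by (simp add: edge_orientation_def)
  then show ?thesis ..
qed

text \<open>
  The partial dual does not depend on the chosen orientation: it exchanges the roles of common and
  edge line segments on the edges in \<open>A\<close>.
\<close>

lemma partial_dual_simps [simp]:
  "flags (partial_dual G T A) = flags G"
  "cseg (partial_dual G T A) = (\<lambda>x. if edge_of G x \<in> A then eseg G x else cseg G x)"
  "vseg (partial_dual G T A) = vseg G"
  "bare (partial_dual G T A) = bare G"
  by (simp_all add: partial_dual_def ribbon_of_arrows_def dual_arrows_def)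

lemma eseg_partial_dual:
  assumes G: "is_ribbon_graph G" and T: "edge_orientation G T" and x: "x \<in> flags G"
  shows "eseg (partial_dual G T A) x = (if edge_of G x \<in> A then cseg G x else eseg G x)"
proof -
  note f = four_flags[OF G x]
  note E = edge_of_seg[OF G x]
  have E': "edge_of G (eseg G (cseg G x)) = edge_of G x"
    using edge_of_seg(2)[OF G f(1)] E(1) by simp
  have T': "cseg G x \<in> T \<longleftrightarrow> x \<notin> T" "eseg G x \<in> T \<longleftrightarrow> x \<notin> T" "eseg G (cseg G x) \<in> T \<longleftrightarrow> x \<in> T"
    using T x f(1) unfolding edge_orientation_def by blast+
  have mem: "q = x \<or> q = cseg G x \<or> q = eseg G x \<or> q = eseg G (cseg G x)"
    if "edge_of G q = edge_of G x" for q
  proof -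
    have "q \<in> edge_of G q" by (simp add: edge_of_def)
    with that show ?thesis by (simp add: edge_of_def)
  qed
  show ?thesis
    unfolding partial_dual_def ribbon_of_arrows_def dual_arrows_def
    by (auto simp: x E E' T' f f(9-14)[symmetric] intro!: the_equality dest!: mem)
qed

lemma is_ribbon_graph_partial_dual:
  assumes G: "is_ribbon_graph G" and T: "edge_orientation G T"
  shows "is_ribbon_graph (partial_dual G T A)"
proof -
  note R = ribbon_graphD[OF G]
  note E = edge_of_seg[OF G]
  have F: "finite (flags G)" "finite (bare G)" using G by (simp_all add: is_ribbon_graph_def)
  show ?thesis
    unfolding is_ribbon_graph_def pairing_on_def
    by (auto simp: F R E R(11)[THEN not_sym] eseg_partial_dual[OF G T])
qed

lemma flip_simps [simp]: "flip a \<noteq> a" "flip (flip a) = a"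
  by (cases a; simp)+

lemma is_ribbon_graph_medial:
  assumes G: "is_ribbon_graph G"
  shows "is_ribbon_graph (medial_graph G)"
proof -
  note R = ribbon_graphD[OF G]
  have "finite (UNIV :: colour set)"
    by (rule finite_subset[of _ "{Black, White}"]) (auto intro: colour.exhaust)
  then show ?thesis
    using G unfolding is_ribbon_graph_def pairing_on_def medial_graph_def
    by (auto split: colour.split)
qed

lemma circle_refl: "x \<in> circle f g x"
  by (simp add: circle_def)

lemma circle_step:
  assumes "y \<in> circle f g x"
  shows "f y \<in> circle f g x" "g y \<in> circle f g x"
  using assms unfolding circle_def by (auto intro: rtranclp.rtrancl_into_rtrancl)

lemma circle_induct [consumes 1, case_names refl left right]:
  assumes "y \<in> circle f g x" "P x"
    "\<And>y. y \<in> circle f g x \<Longrightarrow> P y \<Longrightarrow> P (f y)" "\<And>y. y \<in> circle f g x \<Longrightarrow> P y \<Longrightarrow> P (g y)"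
  shows "P y"
proof -
  have "(\<lambda>u w. w = f u \<or> w = g u)\<^sup>*\<^sup>* x y" using assms(1) by (simp add: circle_def)
  then show ?thesis
    by (induction rule: rtranclp_induct) (use assms in \<open>auto simp: circle_def\<close>)
qed

lemma verts_medial:
  assumes G: "is_ribbon_graph G"
  shows "verts (medial_graph G) = medial_vertex ` edges G"
proof -
  note R = ribbon_graphD[OF G]
  let ?M = "medial_graph G"
  have "circle (cseg ?M) (vseg ?M) (x, a) = edge_of G x \<times> UNIV" if x: "x \<in> flags G" for x a
  proof (intro equalityI subsetI)
    fix p assume "p \<in> circle (cseg ?M) (vseg ?M) (x, a)"
    then show "p \<in> edge_of G x \<times> UNIV"
    proof (induction rule: circle_induct)
      case refl then show ?case by (simp add: edge_of_def)
    next
      case (left p) then show ?case by (auto simp: medial_graph_def)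
    next
      case (right p)
      then show ?case
        by (cases p; cases "snd p") (auto simp: medial_graph_def edge_of_def R x)
    qed
  next
    let ?C = "circle (cseg ?M) (vseg ?M) (x, a)"
    fix p assume p: "p \<in> edge_of G x \<times> (UNIV :: colour set)"
    have fl: "(y, b) \<in> ?C" if "(y, c) \<in> ?C" for y b c
      using that circle_step(1)[OF that] by (cases b; cases c) (auto simp: medial_graph_def)
    have st: "(cseg G y, b) \<in> ?C \<and> (eseg G y, b) \<in> ?C" if "(y, c) \<in> ?C" for y b c
    proof -
      have "vseg ?M (y, Black) \<in> ?C" "vseg ?M (y, White) \<in> ?C"
        by (intro circle_step(2) fl[OF that])+
      moreover have "vseg ?M (y, Black) = (cseg G y, Black)" "vseg ?M (y, White) = (eseg G y, White)"
        by (simp_all add: medial_graph_def)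
      ultimately show ?thesis by (metis fl)
    qed
    have "(x, a) \<in> ?C" by (rule circle_refl)
    then show "p \<in> ?C" using p st fl by (cases p) (simp add: edge_of_def, metis)
  qed
  then show ?thesis
    unfolding verts_def edges_def medial_vertex_def
    by (force simp: medial_graph_def image_iff)
qed

text \<open>Every flag of the medial graph lies on the face of its colour.\<close>

lemma circle_medial:
  "circle (eseg (medial_graph G)) (vseg (medial_graph G)) (x, Black) =
     circle (cseg G) (vseg G) x \<times> {Black}"
  "circle (eseg (medial_graph G)) (vseg (medial_graph G)) (x, White) =
     circle (eseg G) (vseg G) x \<times> {White}"
proof -
  let ?M = "medial_graph G"
  have e: "eseg ?M (y, a) = (vseg G y, a)"
    and b: "vseg ?M (y, Black) = (cseg G y, Black)" and w: "vseg ?M (y, White) = (eseg G y, White)"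
    for y a by (simp_all add: medial_graph_def)
  have "circle (eseg ?M) (vseg ?M) (x, a) = circle f (vseg G) x \<times> {a}"
    if v: "\<And>y. vseg ?M (y, a) = (f y, a)" for f a
  proof (intro equalityI subsetI)
    fix p assume "p \<in> circle (eseg ?M) (vseg ?M) (x, a)"
    then show "p \<in> circle f (vseg G) x \<times> {a}"
      by (induction rule: circle_induct) (auto simp: e v circle_refl intro: circle_step)
  next
    fix p assume "p \<in> circle f (vseg G) x \<times> {a}"
    then obtain y where p: "p = (y, a)" and y: "y \<in> circle f (vseg G) x" by blast
    from y have "(y, a) \<in> circle (eseg ?M) (vseg ?M) (x, a)"
    proof (induction rule: circle_induct)
      case refl show ?case by (rule circle_refl)
    next
      case (left y) from circle_step(2)[OF left(2)] show ?case by (simp only: v)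
    next
      case (right y) from circle_step(1)[OF right(2)] show ?case by (simp only: e)
    qed
    with p show "p \<in> circle (eseg ?M) (vseg ?M) (x, a)" by simp
  qed
  with b w show
    "circle (eseg ?M) (vseg ?M) (x, Black) = circle (cseg G) (vseg G) x \<times> {Black}"
    "circle (eseg ?M) (vseg ?M) (x, White) = circle (eseg G) (vseg G) x \<times> {White}"
    by blast+
qed

lemma checkerboard:
  assumes "x \<in> flags G"
  shows "(\<exists>F\<in>black_faces G. (x, a) \<in> F) \<longleftrightarrow> a = Black"
    and "(\<exists>F\<in>white_faces G. (x, a) \<in> F) \<longleftrightarrow> a = White"
proof -
  let ?M = "medial_graph G"
  have fM: "(x, b) \<in> flags ?M" for b using assms by (simp add: medial_graph_def)
  have face: "circle (eseg ?M) (vseg ?M) (x, b) \<in> faces ?M" for b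
    unfolding faces_def using fM by blast
  have refl: "(x, b) \<in> circle (eseg ?M) (vseg ?M) (x, b)" for b by (rule circle_refl)
  have "Inl (circle (cseg G) (vseg G) x) \<in> verts G" using assms by (simp add: verts_def)
  then have "\<exists>v\<in>verts G. circle (eseg ?M) (vseg ?M) (x, Black) = vertex_flags v \<times> {Black}"
    by (rule bexI[rotated]) (simp add: circle_medial vertex_flags_def)
  with face have black: "circle (eseg ?M) (vseg ?M) (x, Black) \<in> black_faces G"
    by (simp add: black_faces_def)
  have sub: "F \<subseteq> UNIV \<times> {Black}" if "F \<in> black_faces G" for F
    using that by (auto simp: black_faces_def)
  show "(\<exists>F\<in>black_faces G. (x, a) \<in> F) \<longleftrightarrow> a = Black"
    using black sub refl[of Black] by blast
  have white: "circle (eseg ?M) (vseg ?M) (x, White) \<in> white_faces G"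
    using face sub refl[of White] unfolding white_faces_def by blast
  have "F \<in> black_faces G" if F: "F \<in> faces ?M" "(x, Black) \<in> F" for F
  proof -
    from F(1) obtain y b where y: "y \<in> flags G" and Fy: "F = circle (eseg ?M) (vseg ?M) (y, b)"
      by (auto simp: faces_def medial_graph_def)
    with F(2) have b: "b = Black" by (cases b) (auto simp: circle_medial)
    have "Inl (circle (cseg G) (vseg G) y) \<in> verts G" using y by (simp add: verts_def)
    then have "\<exists>v\<in>verts G. F = vertex_flags v \<times> {Black}"
      by (rule bexI[rotated]) (simp add: Fy b circle_medial vertex_flags_def)
    with F(1) show ?thesis by (simp add: black_faces_def)
  qed
  then show "(\<exists>F\<in>white_faces G. (x, a) \<in> F) \<longleftrightarrow> a = White"
    using white refl[of White] unfolding white_faces_def by (cases a) auto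
qed

end

theory Submission
  imports Defs
begin

text \<open>
  Record a direction of \<open>G\<^sub>m\<close> by the set \<open>Q\<close> of flags whose half-edge leaves its vertex, and let
  \<open>p\<close> exchange the ends of the common line segments of the partial dual.  The \<open>d\<close>-edges are those on
  which \<open>Q\<close> is constant along edge line segments only, the \<open>c\<close>-edges those on which it is constant
  along common line segments only, and the \<open>t\<close>-edges those on which it is constant.  So the
  crossing-total directions compatible with \<open>A\<close> are exactly the sets \<open>Q\<close> that are preserved by \<open>p\<close>
  and complemented by \<open>vseg\<close>: walking around a vertex of the partial dual, \<open>Q\<close> alternates from one
  half-edge to the next.  This is possible if and only if the number of half-edges there is even.
\<close>

definition alternates :: "('a \<Rightarrow> 'a) \<Rightarrow> ('a \<Rightarrow> 'a) \<Rightarrow> 'a set \<Rightarrow> 'a set \<Rightarrow> bool" where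
  "alternates p v C Q \<longleftrightarrow> (\<forall>y\<in>C. (p y \<in> Q \<longleftrightarrow> y \<in> Q) \<and> (v y \<in> Q \<longleftrightarrow> y \<notin> Q))"

section \<open>Closed curves formed by two pairings\<close>

lemma pairing_onD:
  assumes "pairing_on X f" "x \<in> X"
  shows "f x \<in> X" "f x \<noteq> x" "f (f x) = x"
  using assms by (auto simp: pairing_on_def)

lemma pairing_on_subset:
  assumes "pairing_on X f" "S \<subseteq> X" "\<And>x. x \<in> S \<Longrightarrow> f x \<in> S"
  shows "pairing_on S f"
  using assms by (auto simp: pairing_on_def)

lemma card_pairs:
  assumes "finite S" and p: "pairing_on S p"
  shows "card S = 2 * card ((\<lambda>y. {y, p y}) ` S)"
proof -
  note P = pairing_onD[OF p]
  have U: "\<Union> ((\<lambda>y. {y, p y}) ` S) = S" using P by auto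
  have "2 * card ((\<lambda>y. {y, p y}) ` S) = card (\<Union> ((\<lambda>y. {y, p y}) ` S))"
  proof (rule card_partition)
    fix c assume "c \<in> (\<lambda>y. {y, p y}) ` S"
    then show "card c = 2" using P(2) by (force simp: card_2_iff)
  next
    fix c1 c2 assume "c1 \<in> (\<lambda>y. {y, p y}) ` S" "c2 \<in> (\<lambda>y. {y, p y}) ` S" "c1 \<noteq> c2"
    then show "c1 \<inter> c2 = {}" using P(3) by (auto simp: doubleton_eq_iff) metis+
  qed (use assms U in auto)
  with U show ?thesis by simp
qed

lemma circle_subset:
  assumes "pairing_on X f" "pairing_on X g" "x \<in> X"
  shows "circle f g x \<subseteq> X"
proof
  fix y assume "y \<in> circle f g x"
  then show "y \<in> X" by (induction rule: circle_induct) (use assms in \<open>auto dest: pairing_onD\<close>)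
qed

lemma circle_trans:
  assumes "y \<in> circle f g x" "z \<in> circle f g y"
  shows "z \<in> circle f g x"
  using assms unfolding circle_def by (auto intro: rtranclp_trans)

lemma circle_seg:
  assumes "pairing_on X f" "pairing_on X g" "x \<in> X"
  shows "circle f g (f x) = circle f g x" "circle f g (g x) = circle f g x"
proof -
  have "f x \<in> circle f g x" "g x \<in> circle f g x"
    by (intro circle_step circle_refl)+
  moreover have "x \<in> circle f g (f x)" "x \<in> circle f g (g x)"
    using circle_step(1)[OF circle_refl, of f "f x" g] circle_step(2)[OF circle_refl, of g "g x" f]
      pairing_onD[OF assms(1,3)] pairing_onD[OF assms(2,3)]
    by simp_all
  ultimately show "circle f g (f x) = circle f g x" "circle f g (g x) = circle f g x"
    by (blast intro: circle_trans)+
qed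

text \<open>\<open>v\<close> matches the points of \<open>C\<close> inside \<open>Q\<close> with
  those outside, and \<open>p\<close> pairs up the points inside; so 4 divides
  \<open>card C\<close>, which is twice the number of pairs.\<close>

lemma even_pairs_of_alternates:
  assumes fin: "finite C" and p: "pairing_on C p" and v: "pairing_on C v"
    and Q: "alternates p v C Q"
  shows "even (card ((\<lambda>y. {y, p y}) ` C))"
proof -
  note P = pairing_onD[OF p] and V = pairing_onD[OF v]
  have "bij_betw v (C \<inter> Q) (C - Q)"
    by (rule bij_betw_byWitness[of _ v]) (use V Q in \<open>auto simp: alternates_def\<close>)
  then have eq: "card (C \<inter> Q) = card (C - Q)" by (rule bij_betw_same_card)
  have "pairing_on (C \<inter> Q) p"
    by (rule pairing_on_subset[OF p]) (use P Q in \<open>auto simp: alternates_def\<close>)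
  then have "even (card (C \<inter> Q))" using card_pairs[of "C \<inter> Q" p] fin by simp
  moreover have "card C = card (C \<inter> Q) + card (C - Q)"
    using fin by (simp add: card_Int_Diff)
  ultimately have "4 dvd card C" using eq by presburger
  then show ?thesis using card_pairs[OF fin p] by presburger
qed

section \<open>Rotation along a closed curve\<close>

context
  fixes X :: "'a set" and p v :: "'a \<Rightarrow> 'a"
  assumes fin: "finite X" and p: "pairing_on X p" and v: "pairing_on X v"
begin

text \<open>One step of a walk that keeps its sense along the curve: first across a
  \<open>p\<close>-segment, then across a \<open>v\<close>-segment.\<close>

private definition r :: "'a \<Rightarrow> 'a" where "r y = v (p y)"

private lemmas P = pairing_onD[OF p] and V = pairing_onD[OF v]

private lemma funpow_round_in: "x \<in> X \<Longrightarrow> (r ^^ i) x \<in> X"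
  by (induction i) (auto simp: r_def intro: P V)

private lemma inj_on_round: "inj_on r X"
  by (rule inj_on_inverseI[of _ "\<lambda>y. p (v y)"]) (simp add: r_def P V)

private lemma funpow_round_cancel:
  assumes "x \<in> X" "(r ^^ (i + k)) x = (r ^^ i) x"
  shows "(r ^^ k) x = x"
  using assms(2)
proof (induction i)
  case (Suc i)
  then have "r ((r ^^ (i + k)) x) = r ((r ^^ i) x)" by simp
  then show ?case
    using Suc.IH inj_onD[OF inj_on_round] funpow_round_in[OF assms(1)] by blast
qed simp

text \<open>Finiteness of \<open>X\<close> forces a repetition among the iterates, and cancellation
  turns it into a return to \<open>x\<close>. Before the least positive return time nothing
  repeats.\<close>

private lemma exists_round_period:
  assumes "x \<in> X"
  obtains n where "0 < n" "(r ^^ n) x = x" "inj_on (\<lambda>i. (r ^^ i) x) {..<n}"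
proof -
  have "\<not> inj (\<lambda>i. (r ^^ i) x)"
    using fin funpow_round_in[OF assms] finite_subset[of "range (\<lambda>i. (r ^^ i) x)" X]
      finite_imageD[of "\<lambda>i. (r ^^ i) x" UNIV] by auto
  then obtain i j where "i < j" "(r ^^ i) x = (r ^^ j) x"
    unfolding inj_def by (metis linorder_neqE_nat)
  then have "(r ^^ (j - i)) x = x" "0 < j - i"
    using funpow_round_cancel[OF assms, of i "j - i"] by simp_all
  then have ex: "\<exists>n. 0 < n \<and> (r ^^ n) x = x" by blast
  define n where "n = (LEAST n. 0 < n \<and> (r ^^ n) x = x)"
  have n: "0 < n" "(r ^^ n) x = x" using LeastI_ex[OF ex] by (simp_all add: n_def)
  have least: "(r ^^ k) x \<noteq> x" if "0 < k" "k < n" for k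
    using not_less_Least[of k "\<lambda>n. 0 < n \<and> (r ^^ n) x = x"] that by (auto simp: n_def)
  have "inj_on (\<lambda>i. (r ^^ i) x) {..<n}"
  proof (rule linorder_inj_onI)
    fix i j assume "i < j" "i \<in> {..<n}" "j \<in> {..<n}"
    then show "(r ^^ i) x \<noteq> (r ^^ j) x"
      using funpow_round_cancel[OF assms, of i "j - i"] least[of "j - i"] by auto
  qed auto
  with n show ?thesis by (rule that)
qed

text \<open>
  Since \<open>p\<close> reverses the sense of rotation \<open>r = v \<circ> p\<close>, an equality \<open>p y = r\<^sup>m y\<close> would produce a
  fixed point of \<open>p\<close> or \<open>v\<close> half-way.
\<close>

private lemma pairing_neq_funpow_round:
  assumes "y \<in> X"
  shows "p y \<noteq> (r ^^ m) y"
  using assms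
\<comment> \<open>An equality for \<open>y\<close> and \<open>m + 2\<close> loses one round at each
  end and becomes one for \<open>r y\<close> and \<open>m\<close>, hence induction in steps of
  two.\<close>
proof (induction m arbitrary: y rule: induct_nat_012)
  case 0 then show ?case using P by simp
next
  case 1 then show ?case using V(2)[OF P(1)] by (simp add: r_def eq_commute)
next
  case (ge2 m)
  have z: "r y \<in> X" using ge2.prems P V by (simp add: r_def)
  have eq: "(r ^^ Suc (Suc m)) y = v (p ((r ^^ m) (r y)))" by (simp add: r_def[symmetric] funpow_swap1)
  show ?case
  proof
    assume "p y = (r ^^ Suc (Suc m)) y"
    then have "v (p y) = v (v (p ((r ^^ m) (r y))))" unfolding eq by (rule arg_cong)
    then have "r y = p ((r ^^ m) (r y))"
      using V(3)[OF P(1)[OF funpow_round_in[OF z]]] by (simp only: r_def)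
    then have "p (r y) = (r ^^ m) (r y)" using P(3) funpow_round_in[OF z] by metis
    with ge2.IH(1)[OF z] show False by simp
  qed
qed

text \<open>Applying \<open>p\<close> to both sides exchanges \<open>i\<close> and \<open>j\<close>,
  so \<open>i \<le> j\<close> may be assumed, and the previous lemma applies at
  \<open>(r ^^ i) x\<close>.\<close>

private lemma pairing_funpow_round_neq:
  assumes x: "x \<in> X"
  shows "p ((r ^^ i) x) \<noteq> (r ^^ j) x"
proof
  have le: "p ((r ^^ i) x) \<noteq> (r ^^ j) x" if "i \<le> j" for i j
    using pairing_neq_funpow_round[OF funpow_round_in[OF x], of i "j - i"] that
    by (simp flip: funpow_add comp_apply[of "r ^^ _" "r ^^ _"])
  assume eq: "p ((r ^^ i) x) = (r ^^ j) x"
  then have "p ((r ^^ j) x) = (r ^^ i) x" using P(3) funpow_round_in[OF x] by metis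
  with eq le show False by (meson nat_le_linear)
qed

text \<open>The curve is the disjoint union of the \<open>r\<close>-orbit of \<open>x\<close> and
  its image under \<open>p\<close>, so the orbit length \<open>n\<close> is the number of pairs. For
  even \<open>n\<close> the parity of the number of rounds is well defined and gives the alternating
  set.\<close>

lemma alternates_of_even_pairs:
  assumes x: "x \<in> X" and even: "even (card ((\<lambda>y. {y, p y}) ` circle p v x))"
  shows "\<exists>Q. alternates p v (circle p v x) Q"
proof -
  obtain n where n: "0 < n" "(r ^^ n) x = x" and inj: "inj_on (\<lambda>i. (r ^^ i) x) {..<n}"
    using exists_round_period[OF x] .
  let ?C = "circle p v x"
  let ?R = "(\<lambda>i. (r ^^ i) x) ` {..<n}"
  have in_X: "(r ^^ i) x \<in> X" for i by (rule funpow_round_in[OF x])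
  have in_R: "(r ^^ i) x \<in> ?R" for i
    using funpow_mod_eq[OF n(2), of i] n(1) by (metis imageI lessThan_iff mod_less_divisor)
  have v_p: "v (p ((r ^^ i) x)) = (r ^^ Suc i) x" for i by (simp add: r_def)
  \<comment> \<open>From the orbit, \<open>v\<close> leads one round back; \<open>i + n - 1\<close>
    expresses index \<open>i - 1\<close> modulo \<open>n\<close> without failing at
    \<open>i = 0\<close>.\<close>
  have v_r: "v ((r ^^ i) x) = p ((r ^^ (i + n - 1)) x)" for i
  proof -
    have "(r ^^ (i + n)) x = (r ^^ i) x" using n(2) by (simp add: funpow_add)
    moreover have "i + n = Suc (i + n - 1)" using n(1) by simp
    ultimately have "(r ^^ i) x = v (p ((r ^^ (i + n - 1)) x))" using v_p by metis
    then show ?thesis using V(3) P(1) in_X by metis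
  qed
  have R_C: "(r ^^ i) x \<in> ?C" for i
    by (induction i) (auto simp: r_def intro: circle_refl circle_step)
  have C: "?C = ?R \<union> p ` ?R"
  proof (intro equalityI subsetI)
    fix y assume "y \<in> ?C"
    then show "y \<in> ?R \<union> p ` ?R"
    proof (induction rule: circle_induct)
      case refl show ?case using in_R[of 0] by (simp only: funpow_0 UnI1)
    next
      case (left y) then show ?case using P(3)[OF in_X] by auto
    next
      case (right y)
      then obtain i where "y = (r ^^ i) x \<or> y = p ((r ^^ i) x)" by blast
      then show ?case using v_p v_r in_R by (metis UnCI imageI)
    qed
  next
    fix y assume "y \<in> ?R \<union> p ` ?R"
    then show "y \<in> ?C" using R_C by (auto intro: circle_step)
  qed
  have C_X: "?C \<subseteq> X" by (rule circle_subset[OF p v x])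
  have "inj_on p ?R" by (rule inj_on_inverseI[of _ p]) (use P(3) in_X in auto)
  moreover have "?R \<inter> p ` ?R = {}"
    using pairing_funpow_round_neq[OF x, symmetric] by blast
  ultimately have "card ?C = 2 * n"
    unfolding C by (simp add: card_Un_disjoint card_image inj)
  moreover have "pairing_on ?C p"
    by (rule pairing_on_subset[OF p C_X]) (rule circle_step)
  ultimately have "even n"
    using card_pairs[of ?C p] even finite_subset[OF C_X fin] by simp
  have parity: "even i \<longleftrightarrow> even j" if "(r ^^ i) x = (r ^^ j) x" for i j
  proof -
    have "i mod n = j mod n"
      using that funpow_mod_eq[OF n(2)] inj_onD[OF inj, of "i mod n" "j mod n"] n(1) by simp
    then show ?thesis using \<open>even n\<close> by (metis dvd_mod_iff)
  qed
  \<comment> \<open>Both ends of a pair receive the parity of its index, so \<open>p\<close>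
    preserves \<open>Q\<close>. \<open>v\<close> changes the index to \<open>i + 1\<close> or
    \<open>i + n - 1\<close>, both of opposite parity because \<open>n\<close> is even.\<close>
  define Q where "Q = {y. \<exists>i. even i \<and> (y = (r ^^ i) x \<or> y = p ((r ^^ i) x))}"
  have Q_r: "(r ^^ i) x \<in> Q \<longleftrightarrow> even i" for i
  proof
    assume "(r ^^ i) x \<in> Q"
    then obtain j where "even j" "(r ^^ i) x = (r ^^ j) x"
      unfolding Q_def using pairing_funpow_round_neq[OF x, symmetric] by blast
    then show "even i" using parity by blast
  qed (auto simp: Q_def)
  have Q_p: "p ((r ^^ i) x) \<in> Q \<longleftrightarrow> even i" for i
  proof
    assume "p ((r ^^ i) x) \<in> Q"
    then obtain j where "even j" "p ((r ^^ i) x) = p ((r ^^ j) x)"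
      unfolding Q_def using pairing_funpow_round_neq[OF x] by blast
    then show "even i" using parity P(3)[OF in_X] by metis
  qed (auto simp: Q_def)
  have "alternates p v ?C Q"
    unfolding alternates_def
  proof
    fix y assume "y \<in> ?C"
    then consider i where "y = (r ^^ i) x" | i where "y = p ((r ^^ i) x)" using C by blast
    then show "(p y \<in> Q \<longleftrightarrow> y \<in> Q) \<and> (v y \<in> Q \<longleftrightarrow> y \<notin> Q)"
    proof cases
      case 1
      then show ?thesis using v_r[of i] Q_r Q_p n(1) \<open>even n\<close> by simp
    next
      case 2
      have "v y = (r ^^ Suc i) x" using 2 v_p by simp
      then show ?thesis using 2 P(3)[OF in_X] Q_r Q_p by (metis even_Suc)
    qed
  qed
  then show ?thesis ..
qed

lemma even_pairs_iff_alternates: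
  "(\<forall>x\<in>X. even (card ((\<lambda>y. {y, p y}) ` circle p v x))) \<longleftrightarrow> (\<exists>Q. alternates p v X Q)"
proof
  assume even: "\<forall>x\<in>X. even (card ((\<lambda>y. {y, p y}) ` circle p v x))"
  \<comment> \<open>The choice depends on the curve as a set and not on a base point, so the sets
    chosen for different curves can be glued.\<close>
  define q where "q C = (SOME Q. alternates p v C Q)" for C
  have q: "alternates p v (circle p v x) (q (circle p v x))" if "x \<in> X" for x
    unfolding q_def by (rule someI_ex) (use alternates_of_even_pairs that even in blast)
  have "alternates p v X {x. x \<in> q (circle p v x)}"
    using q circle_refl[of _ p v] by (auto simp: alternates_def circle_seg[OF p v])
  then show "\<exists>Q. alternates p v X Q" ..
next
  assume "\<exists>Q. alternates p v X Q"
  then obtain Q where Q: "alternates p v X Q" ..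
  show "\<forall>x\<in>X. even (card ((\<lambda>y. {y, p y}) ` circle p v x))"
  proof
    fix x assume "x \<in> X"
    then have sub: "circle p v x \<subseteq> X" by (rule circle_subset[OF p v])
    show "even (card ((\<lambda>y. {y, p y}) ` circle p v x))"
    proof (rule even_pairs_of_alternates)
      show "finite (circle p v x)" using sub fin by (rule finite_subset)
      show "pairing_on (circle p v x) p" "pairing_on (circle p v x) v"
        using pairing_on_subset[OF p sub] pairing_on_subset[OF v sub] circle_step[of _ p v x]
        by blast+
      show "alternates p v (circle p v x) Q" using Q sub by (auto simp: alternates_def)
    qed
  qed
qed

end

text \<open>The half-edges at a vertex are the \<open>cseg\<close>-pairs on its circle; a bare
  vertex has degree 0, which is even.\<close>

lemma eulerian_iff_alternates:
  assumes H: "is_ribbon_graph H"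
  shows "eulerian H \<longleftrightarrow> (\<exists>Q. alternates (cseg H) (vseg H) (flags H) Q)"
proof -
  have fin: "finite (flags H)" and p: "pairing_on (flags H) (cseg H)"
    and v: "pairing_on (flags H) (vseg H)"
    using H by (simp_all add: is_ribbon_graph_def)
  have "degree H (Inr b) = 0" for b
    by (auto simp: degree_def vertex_flags_def half_edges_def half_edge_def)
  moreover have "degree H (Inl (circle (cseg H) (vseg H) x)) =
      card ((\<lambda>y. {y, cseg H y}) ` circle (cseg H) (vseg H) x)" if "x \<in> flags H" for x
  proof -
    have "{h \<in> half_edges H. h \<subseteq> circle (cseg H) (vseg H) x} =
        (\<lambda>y. {y, cseg H y}) ` circle (cseg H) (vseg H) x"
      using circle_subset[OF p v that]
      by (auto simp: half_edges_def half_edge_def intro: circle_step)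
    then show ?thesis by (simp add: degree_def vertex_flags_def)
  qed
  ultimately have "eulerian H \<longleftrightarrow>
      (\<forall>x\<in>flags H. even (card ((\<lambda>y. {y, cseg H y}) ` circle (cseg H) (vseg H) x)))"
    by (simp add: eulerian_def verts_def ball_Un)
  then show ?thesis using even_pairs_iff_alternates[OF fin p v] by simp
qed

section \<open>Directions of the medial graph\<close>

text \<open>Each half-edge of the medial graph is the fibre over a single flag of \<open>G\<close>,
  so a direction is determined by this set.\<close>

definition out_flags :: "('f \<times> colour) set set \<Rightarrow> 'f set" where
  "out_flags D = {x. {x} \<times> UNIV \<in> D}"

lemma half_edge_medial: "half_edge (medial_graph G) (x, a) = {x} \<times> UNIV"
proof -
  have "UNIV = {a, flip a}" by (cases a) (auto intro: colour.exhaust)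
  then show ?thesis by (auto simp: half_edge_def medial_graph_def)
qed

lemma direction_medial:
  "direction (medial_graph G) D \<longleftrightarrow> D \<subseteq> (\<lambda>x. {x} \<times> UNIV) ` flags G \<and>
     (\<forall>x\<in>flags G. x \<in> out_flags D \<longleftrightarrow> vseg G x \<notin> out_flags D)"
proof -
  have flags: "flags (medial_graph G) = flags G \<times> UNIV" by (simp add: medial_graph_def)
  have "half_edges (medial_graph G) = (\<lambda>x. {x} \<times> UNIV) ` flags G"
    unfolding half_edges_def flags by (auto simp: half_edge_medial image_iff)
  moreover have "eseg (medial_graph G) (x, a) = (vseg G x, a)" for x a
    by (simp add: medial_graph_def)
  ultimately show ?thesis
    by (auto simp: flags direction_def half_edge_medial out_flags_def)
qed

text \<open>\<open>rot\<close> crosses black and white corners alternately. From a black flag the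
  walk over the flags of \<open>G\<close> is \<open>x\<close>, \<open>cseg G x\<close>,
  \<open>eseg G (cseg G x)\<close>, \<open>eseg G x\<close>; from a white flag \<open>cseg\<close>
  and \<open>eseg\<close> exchange roles.\<close>

lemma in_in_out_out_medial:
  assumes G: "is_ribbon_graph G" and x: "x \<in> flags G"
  shows "in_in_out_out (medial_graph G) D (x, Black) \<longleftrightarrow>
      x \<notin> out_flags D \<and> cseg G x \<notin> out_flags D \<and>
      eseg G (cseg G x) \<in> out_flags D \<and> eseg G x \<in> out_flags D"
    and "in_in_out_out (medial_graph G) D (x, White) \<longleftrightarrow>
      x \<notin> out_flags D \<and> eseg G x \<notin> out_flags D \<and>
      eseg G (cseg G x) \<in> out_flags D \<and> cseg G x \<in> out_flags D"
proof -
  have rot: "rot (medial_graph G) (y, Black) = (cseg G y, White)"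
    "rot (medial_graph G) (y, White) = (eseg G y, Black)" for y
    by (simp_all add: rot_def medial_graph_def)
  show "in_in_out_out (medial_graph G) D (x, Black) \<longleftrightarrow>
      x \<notin> out_flags D \<and> cseg G x \<notin> out_flags D \<and>
      eseg G (cseg G x) \<in> out_flags D \<and> eseg G x \<in> out_flags D"
    "in_in_out_out (medial_graph G) D (x, White) \<longleftrightarrow>
      x \<notin> out_flags D \<and> eseg G x \<notin> out_flags D \<and>
      eseg G (cseg G x) \<in> out_flags D \<and> cseg G x \<in> out_flags D"
    by (simp_all add: in_in_out_out_def rot half_edge_medial out_flags_def four_flags[OF G x])
qed

section \<open>Edge types read off from the flags\<close>

context
  fixes G :: "('f, 'v) ribbon_graph" and x :: 'f and w :: "('f \<times> colour) set + 'v"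
  assumes G: "is_ribbon_graph G" and x: "x \<in> flags G"
    and w: "w = medial_vertex (edge_of G x)"
begin

private lemma vertex_flags_w: "vertex_flags w = edge_of G x \<times> UNIV"
  by (simp add: w vertex_flags_def medial_vertex_def)

private lemma bex_vertex_flags_w:
  "(\<exists>y\<in>vertex_flags w. R y) \<longleftrightarrow> (\<exists>y\<in>edge_of G x. R (y, Black) \<or> R (y, White))"
  unfolding vertex_flags_w by (auto; metis (full_types) colour.exhaust)

text \<open>By \<open>checkerboard\<close> only starts at black flags count. The four possible
  starts cover both choices of the incoming common line segment, which is why the condition is
  relative to \<open>x\<close>.\<close>

lemma c_vertex_iff:
  "c_vertex G D w \<longleftrightarrow>
     (cseg G x \<in> out_flags D \<longleftrightarrow> x \<in> out_flags D) \<and>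
     (eseg G x \<in> out_flags D \<longleftrightarrow> x \<notin> out_flags D) \<and>
     (eseg G (cseg G x) \<in> out_flags D \<longleftrightarrow> x \<notin> out_flags D)"
  unfolding c_vertex_def bex_vertex_flags_w
  using four_flags[OF G x] x
  by (auto simp: edge_of_def checkerboard in_in_out_out_medial[OF G])

lemma d_vertex_iff:
  "d_vertex G D w \<longleftrightarrow>
     (eseg G x \<in> out_flags D \<longleftrightarrow> x \<in> out_flags D) \<and>
     (cseg G x \<in> out_flags D \<longleftrightarrow> x \<notin> out_flags D) \<and>
     (eseg G (cseg G x) \<in> out_flags D \<longleftrightarrow> x \<notin> out_flags D)"
  unfolding d_vertex_def bex_vertex_flags_w
  using four_flags[OF G x] x
  by (auto simp: edge_of_def checkerboard in_in_out_out_medial[OF G])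

lemma t_vertex_iff:
  "t_vertex G D w \<longleftrightarrow>
     (eseg G x \<in> out_flags D \<longleftrightarrow> x \<in> out_flags D) \<and>
     (cseg G x \<in> out_flags D \<longleftrightarrow> x \<in> out_flags D) \<and>
     (eseg G (cseg G x) \<in> out_flags D \<longleftrightarrow> x \<in> out_flags D)"
  unfolding t_vertex_def all_in_or_all_out_def vertex_flags_w
  by (auto simp: edge_of_def half_edge_medial out_flags_def)

lemma ex_in_in_out_out_iff:
  "(\<exists>y\<in>vertex_flags w. in_in_out_out (medial_graph G) D y) \<longleftrightarrow> c_vertex G D w \<or> d_vertex G D w"
proof -
  have "y \<in> flags G" if "y \<in> edge_of G x" for y using edge_of_cong(1)[OF G x that] .
  then show ?thesis
    unfolding c_vertex_def d_vertex_def bex_vertex_flags_w by (auto simp: checkerboard)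
qed

end

section \<open>Crossing-total directions compatible with \<open>A\<close>\<close>

lemma crossing_total_direction_iff:
  assumes G: "is_ribbon_graph G"
  shows "crossing_total_direction G D \<longleftrightarrow> direction (medial_graph G) D \<and>
    edges G = c_edges G D \<union> d_edges G D \<union> t_edges G D"
proof -
  have "(\<exists>y\<in>vertex_flags w. in_in_out_out (medial_graph G) D y) \<or>
      all_in_or_all_out (medial_graph G) D w \<longleftrightarrow>
      c_vertex G D w \<or> d_vertex G D w \<or> t_vertex G D w"
    if "w = medial_vertex e" "e \<in> edges G" for w :: "('a \<times> colour) set + 'b" and e
    using that ex_in_in_out_out_iff[OF G] by (auto simp: edges_def t_vertex_def)
  then show ?thesis
    unfolding crossing_total_direction_def verts_medial[OF G]
    by (auto simp: c_edges_def d_edges_def t_edges_def)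
qed

text \<open>Compatibility says that edges in \<open>A\<close> have type d or t and the others type c
  or t. Type d or t means constancy along edge line segments, type c or t constancy along common
  line segments.\<close>

lemma compatible_direction_iff:
  assumes G: "is_ribbon_graph G" and A: "A \<subseteq> edges G" and D: "direction (medial_graph G) D"
  shows "crossing_total_direction G D \<and> (\<exists>S. S \<subseteq> t_edges G D \<and> A = d_edges G D \<union> S) \<longleftrightarrow>
    (\<forall>x\<in>flags G. (if edge_of G x \<in> A then eseg G x else cseg G x) \<in> out_flags D \<longleftrightarrow>
       x \<in> out_flags D)"
    (is "?L \<longleftrightarrow> (\<forall>x\<in>flags G. ?P x)")
proof -
  have edge: "edge_of G x \<in> edges G" if "x \<in> flags G" for x using that by (simp add: edges_def)
  note types = c_edges_def d_edges_def t_edges_def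
  note iffs = c_vertex_iff[OF G _ refl] d_vertex_iff[OF G _ refl] t_vertex_iff[OF G _ refl]
  have "?L \<longleftrightarrow> (\<forall>e\<in>edges G. if e \<in> A then e \<in> d_edges G D \<union> t_edges G D
      else e \<in> c_edges G D \<union> t_edges G D)"
    (is "_ \<longleftrightarrow> (\<forall>e\<in>edges G. ?E e)")
  proof
    assume ?L
    then show "\<forall>e\<in>edges G. ?E e" using crossing_total_direction_iff[OF G] by auto
  next
    assume E: "\<forall>e\<in>edges G. ?E e"
    \<comment> \<open>A d-edge outside \<open>A\<close> would also be a c-edge or a t-edge, which
      this excludes.\<close>
    have "d_edges G D \<inter> (c_edges G D \<union> t_edges G D) = {}"
      by (auto simp: types edges_def iffs)
    with E have "d_edges G D \<subseteq> A" by (fastforce simp: d_edges_def)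
    moreover have "A - d_edges G D \<subseteq> t_edges G D" using E A by (meson DiffE UnE subset_iff)
    moreover have "edges G = c_edges G D \<union> d_edges G D \<union> t_edges G D"
      using E by (auto simp: types split: if_splits)
    ultimately show ?L
      using D by (auto simp: crossing_total_direction_iff[OF G] intro!: exI[of _ "A - d_edges G D"])
  qed
  also have "\<dots> \<longleftrightarrow> (\<forall>x\<in>flags G. ?E (edge_of G x))" by (simp add: edges_def)
  also have "\<dots> \<longleftrightarrow> (\<forall>x\<in>flags G. ?P x)"
  proof
    assume "\<forall>x\<in>flags G. ?E (edge_of G x)"
    then show "\<forall>x\<in>flags G. ?P x" by (auto simp: types iffs)
  next
    assume R: "\<forall>x\<in>flags G. ?P x"
    show "\<forall>x\<in>flags G. ?E (edge_of G x)"
    proof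
      fix x assume x: "x \<in> flags G"
      \<comment> \<open>The two edge line segments of the edge contain \<open>x\<close> and
        \<open>cseg G x\<close>, its two common line segments \<open>x\<close> and
        \<open>eseg G x\<close>; these three instances therefore settle both cases.\<close>
      have "?P x" "?P (cseg G x)" "?P (eseg G x)" using R four_flags[OF G x] x by blast+
      then show "?E (edge_of G x)"
        using x by (auto simp: types iffs edge edge_of_seg[OF G x] four_flags[OF G x])
    qed
  qed
  finally show ?thesis .
qed

theorem theorem1p4:
  fixes G :: "('f, 'v) ribbon_graph" and A :: "'f set set" and T :: "'f set"
  assumes "is_ribbon_graph G"
    and "A \<subseteq> edges G"
    and "edge_orientation G T"
  shows "eulerian (partial_dual G T A) \<longleftrightarrow>
    (\<exists>D. crossing_total_direction G D \<and>
         (\<exists>S. S \<subseteq> t_edges G D \<and> A = d_edges G D \<union> S))"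
proof -
  let ?p = "\<lambda>x. if edge_of G x \<in> A then eseg G x else cseg G x"
  note compatible = compatible_direction_iff[OF assms(1,2)]
  have "eulerian (partial_dual G T A) \<longleftrightarrow> (\<exists>Q. alternates ?p (vseg G) (flags G) Q)"
    using eulerian_iff_alternates[OF is_ribbon_graph_partial_dual[OF assms(1,3)]] by simp
  also have "\<dots> \<longleftrightarrow> (\<exists>D. direction (medial_graph G) D \<and>
      (\<forall>x\<in>flags G. ?p x \<in> out_flags D \<longleftrightarrow> x \<in> out_flags D))"
  proof
    assume "\<exists>Q. alternates ?p (vseg G) (flags G) Q"
    then obtain Q where Q: "alternates ?p (vseg G) (flags G) Q" ..
    \<comment> \<open>Nothing restricts \<open>Q\<close> outside \<open>flags G\<close>, so it is
      cut down to make \<open>D\<close> a set of half-edges.\<close>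
    define D :: "('f \<times> colour) set set" where "D = (\<lambda>x. {x} \<times> UNIV) ` (Q \<inter> flags G)"
    have "out_flags D = Q \<inter> flags G" by (auto simp: out_flags_def D_def times_eq_iff)
    then have "direction (medial_graph G) D"
      "\<forall>x\<in>flags G. ?p x \<in> out_flags D \<longleftrightarrow> x \<in> out_flags D"
      using Q ribbon_graphD[OF assms(1)]
      by (auto simp: direction_medial alternates_def D_def)
    then show "\<exists>D. direction (medial_graph G) D \<and>
        (\<forall>x\<in>flags G. ?p x \<in> out_flags D \<longleftrightarrow> x \<in> out_flags D)" by blast
  next
    assume "\<exists>D. direction (medial_graph G) D \<and>
        (\<forall>x\<in>flags G. ?p x \<in> out_flags D \<longleftrightarrow> x \<in> out_flags D)"
    \<comment> \<open>The witness is \<open>out_flags D\<close>; \<open>direction_medial\<close>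
      supplies the alternation along corners.\<close>
    then show "\<exists>Q. alternates ?p (vseg G) (flags G) Q"
      unfolding alternates_def direction_medial by metis
  qed
  also have "\<dots> \<longleftrightarrow> (\<exists>D. crossing_total_direction G D \<and>
      (\<exists>S. S \<subseteq> t_edges G D \<and> A = d_edges G D \<union> S))"
    using compatible unfolding crossing_total_direction_def by blast
  finally show ?thesis .
qed

end
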